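(* Let $f:Q\to\mathbb{R}$ be Lipschitz continuous with constant $M_f>0$ and $\gamma$-quasar convex with center $x_*$, $\gamma\in(0,1]$, and let $g_i:Q\to\mathbb{R}$, $i=1,\dots,m$, be convex and Lipschitz continuous with constants $M_{g_i}>0$, where $x_*$ is a solution of $\min\{f(x): x\in Q,\ g_i(x)\le0,\ i=1,\dots,m\}$. Put $M_g=\max_{1\le i\le m}M_{g_i}$ and $g(x)=\max_{1\le i\le m}g_i(x)$, and assume that for all $x\in Q$, $\|\nabla f(x)\|_*\le M_f$ and $\|\nabla g_i(x)\|_*\le M_g$ for all $i=1,\dots,m$. Let $\Theta_0>0$ satisfy $\sup_{x,y\in Q}V(y,x)\le\Theta_0^2$, let $\varepsilon>0$ and let $x_0\in Q$ be a starting point. Consider the following algorithm. For $k=0,1,2,\dots$: - if $g_i(x_k)\le\varepsilon$ for all $i=1,\dots,m$ (productive step), set $M_k=\|\nabla f(x_k)\|_*$, $h_k=\Theta_0\big(\sum_{i=0}^{k}M_i^2\big)^{-1/2}$, $x_{k+1}=\operatorname{Mirr}_{x_k}(h_k\nabla f(x_k))$, and add $k$ to the set $I$ (initially empty); - otherwise (non-productive step), take some $q(k)\in\{1,\dots,m\}$ with $g_{q(k)}(x_k)>\varepsilon$ and set $M_k=\|\nabla g_{q(k)}(x_k)\|_*$, $h_k=\Theta_0\big(\sum_{i=0}^{k}M_i^2\big)^{-1/2}$, $x_{k+1}=\operatorname{Mirr}_{x_k}(h_k\nabla g_{q(k)}(x_k))$. The algorithm stops after the first number $k\ge1$ of performed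 iterations (indexed $0,\dots,k-1$) for which $$k\ \ge\ \frac{2\Theta_0}{\varepsilon}\Big(1+\frac1\gamma\Big)\Big(\sum_{i=0}^{k-1}M_i^2\Big)^{1/2},$$ and outputs $\hat x=\arg\min_{i\in I}f(x_i)$ (a point $x_i$, $i\in I$, with the smallest value of $f$). Then $I\neq\emptyset$, the algorithm stops after not more than $$\left\lceil\frac{4\max\{M_f^2,M_g^2\}\,\Theta_0^2\big(1+\frac1\gamma\big)^2}{\varepsilon^2}\right\rceil$$ iterations, and its output satisfies $f(\hat x)-f(x_* )\le\varepsilon$ and $g(\hat x)\le\varepsilon$.
   Context: $(\mathbf{E},\|\cdot\|)$ is a finite-dimensional normed space with dual $\mathbf{E}^*$ and dual norm $\|y\|_*=\max\{\langle y,x\rangle:\|x\|\le1\}$. $Q\subset\mathbf{E}$ is closed and convex. $d:Q\to\mathbb{R}$ is a proper, closed, differentiable function that is $1$-strongly convex with respect to $\|\cdot\|$ (prox-function). The Bregman divergence is $V(y,x)=d(y)-d(x)-\langle\nabla d(x),y-x\rangle$, $x,y\in Q$; it satisfies $V(y,x)\ge\frac12\|y-x\|^2$. The proximal mapping is $\operatorname{Mirr}_x(p)=\arg\min_{u\in Q}\{\langle p,u\rangle+V(u,x)\}$ for $x\in Q$, $p\in\mathbf{E}^*$. For a function $\phi$ on $Q$, $\nabla\phi(x)\in\partial\phi(x)$ denotes an arbitrary (sub)gradient of $\phi$ at $x$. A function $\phi$ is Lipschitz continuous with constant $M$ if $|\phi(x)-\phi(y)|\le M\|x-y\|$ for all $x,y\in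 Q$. For $\gamma\in(0,1]$, $f:Q\to\mathbb{R}$ is $\gamma$-quasar convex with center $x_*\in Q$ if $x_*\in\arg\min_{x\in Q}f(x)$ and $f(x_* )\ge f(x)+\frac1\gamma\langle\nabla f(x),x_*-x\rangle$ for all $x\in Q$. The problem is assumed feasible (regular): there is a point $\bar x$ in the interior of $Q$ with $g(\bar x)\le0$. The step sizes are understood to be well defined ($\sum_{i=0}^kM_i^2>0$ whenever $h_k$ is computed). *)

theory Defs
  imports "HOL-Analysis.Analysis"
begin

(* The primal space E is a finite-dimensional type 'a :: real_normed_vector with an arbitrary norm.
   The dual space is 'a \<Rightarrow>\<^sub>L real; its norm, the operator norm, is the dual norm. *)

definition finite_dimensional :: "'a::real_vector itself \<Rightarrow> bool" where
  "finite_dimensional _ \<longleftrightarrow> (\<exists>B :: 'a set. finite B \<and> span B = UNIV)"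

definition strongly_convex_on :: "real \<Rightarrow> 'a::real_normed_vector set \<Rightarrow> ('a \<Rightarrow> real) \<Rightarrow> bool" where
  "strongly_convex_on \<mu> Q d \<longleftrightarrow> convex Q \<and>
     (\<forall>x\<in>Q. \<forall>y\<in>Q. \<forall>t\<in>{0..1}.
        d ((1 - t) *\<^sub>R x + t *\<^sub>R y) \<le> (1 - t) * d x + t * d y - \<mu> / 2 * t * (1 - t) * (norm (x - y))\<^sup>2)"

(* A real-valued d on Q, extended by infinity outside Q, is proper iff Q is nonempty and closed
   iff its epigraph over Q is closed. *)
definition prox_function :: "'a::real_normed_vector set \<Rightarrow> ('a \<Rightarrow> real) \<Rightarrow> bool" where
  "prox_function Q d \<longleftrightarrow>
     Q \<noteq> {} \<and> closed (epigraph Q d) \<and> d differentiable_on Q \<and> strongly_convex_on 1 Q d"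

(* At boundary points of Q the derivative of d is the one relative to Q, which is unique
   as soon as the convex set Q has nonempty interior. *)
definition Bregman :: "'a::real_normed_vector set \<Rightarrow> ('a \<Rightarrow> real) \<Rightarrow> 'a \<Rightarrow> 'a \<Rightarrow> real" where
  "Bregman Q d y x = d y - d x - frechet_derivative d (at x within Q) (y - x)"

definition Mirr :: "'a::real_normed_vector set \<Rightarrow> ('a \<Rightarrow> real) \<Rightarrow> 'a \<Rightarrow> ('a \<Rightarrow>\<^sub>L real) \<Rightarrow> 'a" where
  "Mirr Q d x p = arg_min_on (\<lambda>u. blinfun_apply p u + Bregman Q d u x) Q"

definition subdifferential ::
    "'a::real_normed_vector set \<Rightarrow> ('a \<Rightarrow> real) \<Rightarrow> 'a \<Rightarrow> ('a \<Rightarrow>\<^sub>L real) set" where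
  "subdifferential Q \<phi> x = {p. \<forall>y\<in>Q. \<phi> y \<ge> \<phi> x + blinfun_apply p (y - x)}"

(* f' x is the chosen (sub)gradient of f at x.  A quasar-convex f need be neither convex nor
   differentiable, and for such f the convex subdifferential may be empty.  No particular
   generalized subdifferential is fixed: f' is an arbitrary covector field satisfying the
   quasar-convexity inequality, whichever notion of (sub)gradient it has been selected from. *)
definition quasar_convex ::
    "real \<Rightarrow> 'a::real_normed_vector set \<Rightarrow> ('a \<Rightarrow> real) \<Rightarrow> ('a \<Rightarrow> 'a \<Rightarrow>\<^sub>L real) \<Rightarrow> 'a \<Rightarrow> bool" where
  "quasar_convex \<gamma> Q f f' c \<longleftrightarrow> 0 < \<gamma> \<and> \<gamma> \<le> 1 \<and> is_arg_min f (\<lambda>x. x \<in> Q) c \<and>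
     (\<forall>x\<in>Q. f c \<ge> f x + 1 / \<gamma> * blinfun_apply (f' x) (c - x))"

definition productive :: "nat \<Rightarrow> (nat \<Rightarrow> 'a \<Rightarrow> real) \<Rightarrow> real \<Rightarrow> 'a \<Rightarrow> bool" where
  "productive m g \<epsilon> z \<longleftrightarrow> (\<forall>i\<in>{1..m}. g i z \<le> \<epsilon>)"

definition stop_test :: "real \<Rightarrow> real \<Rightarrow> real \<Rightarrow> (nat \<Rightarrow> real) \<Rightarrow> nat \<Rightarrow> bool" where
  "stop_test \<Theta> \<epsilon> \<gamma> M k \<longleftrightarrow>
     k \<ge> 1 \<and> real k \<ge> 2 * \<Theta> / \<epsilon> * (1 + 1 / \<gamma>) * sqrt (\<Sum>i<k. (M i)\<^sup>2)"

(* Iteration k (counted from 0) is carried out iff no number j \<le> k of performed iterations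
   has triggered the stopping test. *)
definition performed :: "real \<Rightarrow> real \<Rightarrow> real \<Rightarrow> (nat \<Rightarrow> real) \<Rightarrow> nat \<Rightarrow> bool" where
  "performed \<Theta> \<epsilon> \<gamma> M k \<longleftrightarrow> (\<forall>j\<le>k. \<not> stop_test \<Theta> \<epsilon> \<gamma> M j)"

definition stops_after :: "real \<Rightarrow> real \<Rightarrow> real \<Rightarrow> (nat \<Rightarrow> real) \<Rightarrow> nat \<Rightarrow> bool" where
  "stops_after \<Theta> \<epsilon> \<gamma> M N \<longleftrightarrow>
     stop_test \<Theta> \<epsilon> \<gamma> M N \<and> (\<forall>j<N. \<not> stop_test \<Theta> \<epsilon> \<gamma> M j)"

(* The sequences x, q, M, h are constrained only as long as the algorithm is running. *)
definition mirror_descent_run ::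
    "'a::real_normed_vector set \<Rightarrow> ('a \<Rightarrow> real) \<Rightarrow> ('a \<Rightarrow> 'a \<Rightarrow>\<^sub>L real) \<Rightarrow>
     nat \<Rightarrow> (nat \<Rightarrow> 'a \<Rightarrow> real) \<Rightarrow> (nat \<Rightarrow> 'a \<Rightarrow> 'a \<Rightarrow>\<^sub>L real) \<Rightarrow>
     real \<Rightarrow> real \<Rightarrow> real \<Rightarrow> 'a \<Rightarrow>
     (nat \<Rightarrow> 'a) \<Rightarrow> (nat \<Rightarrow> nat) \<Rightarrow> (nat \<Rightarrow> real) \<Rightarrow> (nat \<Rightarrow> real) \<Rightarrow> bool" where
  "mirror_descent_run Q d f' m g g' \<Theta> \<epsilon> \<gamma> x0 x q M h \<longleftrightarrow>
     x 0 = x0 \<and>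
     (\<forall>k. performed \<Theta> \<epsilon> \<gamma> M k \<longrightarrow>
        h k = \<Theta> / sqrt (\<Sum>i\<le>k. (M i)\<^sup>2) \<and>
        (if productive m g \<epsilon> (x k)
         then M k = norm (f' (x k)) \<and>
              x (Suc k) = Mirr Q d (x k) (h k *\<^sub>R f' (x k))
         else q k \<in> {1..m} \<and> g (q k) (x k) > \<epsilon> \<and>
              M k = norm (g' (q k) (x k)) \<and>
              x (Suc k) = Mirr Q d (x k) (h k *\<^sub>R g' (q k) (x k))))"

end

theory Submission
  imports Defs
begin

text \<open>
Write \<open>p\<^sub>k\<close> for the subgradient used in step \<open>k\<close>: that of the objective in a productive step, that
of a violated constraint otherwise, so that \<open>M k\<close> is its norm. The algorithm is mirror descent for
the linear losses \<open>p\<^sub>k\<close>, and the proof compares two estimates of its regret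
\<open>R = (\<Sum>k<N. p\<^sub>k (x k - xs))\<close> against the solution \<open>xs\<close>.

From above, optimality of the mirror step and \<open>V(y, x) \<ge> norm (y - x)\<^sup>2 / 2\<close> give
\<open>h k * p\<^sub>k (x k - xs) \<le> (h k)\<^sup>2 (M k)\<^sup>2 / 2 + V(xs, x k) - V(xs, x (Suc k))\<close>
(\<open>mirror_step_inequality\<close>). Dividing by \<open>h k\<close> and summing leaves two sums. With
\<open>S k = (\<Sum>i\<le>k. (M i)\<^sup>2)\<close> and \<open>h k = \<Theta> / sqrt (S k)\<close>, the first is
\<open>\<Theta> / 2 * (\<Sum>k<N. (M k)\<^sup>2 / sqrt (S k)) \<le> \<Theta> * sqrt (S (N - 1))\<close>; the second telescopes up to the
nondecreasing weights \<open>1 / h k\<close> and is at most \<open>\<Theta>\<^sup>2 / h (N - 1) = \<Theta> * sqrt (S (N - 1))\<close>. So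
\<open>R \<le> 2 * \<Theta> * sqrt (S (N - 1))\<close> (\<open>mirror_descent_regret\<close>), and the stopping test says exactly that
this bound is at most \<open>\<epsilon> * N / (1 + 1 / \<gamma>)\<close>.

From below, quasar convexity gives \<open>p\<^sub>k (x k - xs) \<ge> \<gamma> * (f (x k) - f xs)\<close> in a productive step, and
convexity of the violated constraint together with feasibility of \<open>xs\<close> gives
\<open>p\<^sub>k (x k - xs) > \<epsilon>\<close> in any other step. If no step were productive, or if the objective gap exceeded
\<open>\<epsilon>\<close> in all productive ones, these lower bounds would add up to more than the upper bound
(\<open>small_regret_imp_small_gap\<close>).

The algorithm stops because the right-hand side of the test grows only like the square root of the
number of steps (\<open>stop_test_if_large\<close>). The iterates exist because the objective of the mirror step
is continuous and \<open>Q\<close> is compact: the bound on \<open>V\<close> makes \<open>Q\<close> bounded, and the space has finite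
dimension.
\<close>

section \<open>Bounded closed sets in finite-dimensional normed spaces\<close>

text \<open>The induction adds one vector \<open>b\<close> at a time. Compactness of balls in \<open>span B\<close> puts \<open>b\<close> at a
positive distance \<open>\<delta>\<close> from \<open>span B\<close>. This \<open>\<delta>\<close> bounds the coefficient of \<open>b\<close> in any vector of norm
at most \<open>r\<close>, which therefore lies in the image of a compact product under \<open>(a, t) \<mapsto> a *\<^sub>R b + t\<close>.\<close>

lemma compact_cball_Int_span:
  fixes B :: "'a::real_normed_vector set"
  assumes "finite B"
  shows "compact (cball 0 r \<inter> span B)"
  using assms
proof (induction B arbitrary: r rule: finite_induct)
  case empty
  then show ?case by (simp add: compact_Int_closed Int_commute closed_Int_compact)
next
  case (insert b B)
  show ?case
  proof (cases "b \<in> span B")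
    case True
    then show ?thesis using insert.IH by (simp add: span_redundant)
  next
    case False
    \<comment> \<open>Vectors of \<open>span B\<close> at distance less than 1 from \<open>b\<close> lie in this ball, so that its
        closedness suffices to separate \<open>b\<close> from all of \<open>span B\<close>.\<close>
    let ?C = "cball 0 (norm b + 1) \<inter> span B"
    have "open (- ?C)" using insert.IH[of "norm b + 1"] compact_imp_closed by blast
    moreover have "b \<in> - ?C" using False by simp
    ultimately obtain e where e: "e > 0" "ball b e \<subseteq> - ?C"
      by (meson open_contains_ball)
    define \<delta> where "\<delta> = min e 1"
    have \<delta>: "\<delta> > 0" using e by (simp add: \<delta>_def)
    have far: "norm (b - t) \<ge> \<delta>" if "t \<in> span B" for t
    proof (rule ccontr)
      assume "\<not> norm (b - t) \<ge> \<delta>"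
      then have "norm (b - t) < e" "norm (b - t) < 1" by (auto simp: \<delta>_def)
      moreover from this have "norm t \<le> norm b + 1"
        by (smt (verit) norm_triangle_ineq2 norm_minus_commute)
      ultimately show False using e(2) that by (auto simp: dist_norm subset_iff)
    qed
    have coef: "\<bar>a\<bar> * \<delta> \<le> norm (a *\<^sub>R b + t)" if "t \<in> span B" for a t
    proof (cases "a = 0")
      case False
      have "- ((1 / a) *\<^sub>R t) \<in> span B" using that span_scale span_neg by blast
      then have "\<delta> \<le> norm (b + (1 / a) *\<^sub>R t)" using far by fastforce
      then have "\<bar>a\<bar> * \<delta> \<le> norm (a *\<^sub>R (b + (1 / a) *\<^sub>R t))"
        by (simp add: mult_left_mono)
      then show ?thesis using False by (simp add: scaleR_right_distrib)
    qed simp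
    \<comment> \<open>\<open>R\<close> bounds the component in \<open>span B\<close>, by the triangle inequality for \<open>z - a *\<^sub>R b\<close>.\<close>
    define R where "R = \<bar>r\<bar> + \<bar>r\<bar> / \<delta> * norm b"
    define K where "K = (\<lambda>(a, t). a *\<^sub>R b + t) ` ({- (\<bar>r\<bar> / \<delta>)..\<bar>r\<bar> / \<delta>} \<times> (cball 0 R \<inter> span B))"
    have "compact K" unfolding K_def
      by (intro compact_continuous_image compact_Times insert.IH compact_Icc)
        (auto simp: case_prod_unfold intro!: continuous_intros)
    moreover have "cball 0 r \<inter> span (insert b B) = cball 0 r \<inter> K"
    proof (intro equalityI subsetI)
      fix z assume z: "z \<in> cball 0 r \<inter> span (insert b B)"
      then obtain a where a: "z - a *\<^sub>R b \<in> span B" by (auto simp: span_breakdown_eq)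
      define t where "t = z - a *\<^sub>R b"
      have zt: "z = a *\<^sub>R b + t" "t \<in> span B" using a by (auto simp: t_def)
      have "\<bar>a\<bar> * \<delta> \<le> \<bar>r\<bar>" using coef[OF zt(2), of a] z zt(1) by auto
      then have a': "\<bar>a\<bar> \<le> \<bar>r\<bar> / \<delta>" using \<delta> by (simp add: field_simps)
      have "norm t \<le> norm z + \<bar>a\<bar> * norm b"
        using norm_triangle_ineq4[of z "a *\<^sub>R b"] by (simp add: t_def)
      also have "\<dots> \<le> R" unfolding R_def
        using z a' by (intro add_mono mult_right_mono) auto
      finally have "(a, t) \<in> {- (\<bar>r\<bar> / \<delta>)..\<bar>r\<bar> / \<delta>} \<times> (cball 0 R \<inter> span B)"
        using a' zt by auto
      then show "z \<in> cball 0 r \<inter> K" using z zt(1) unfolding K_def by force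
    next
      fix z assume z: "z \<in> cball 0 r \<inter> K"
      then obtain a t where "z = a *\<^sub>R b + t" "t \<in> span B" unfolding K_def by auto
      then show "z \<in> cball 0 r \<inter> span (insert b B)"
        using z by (auto simp: span_breakdown_eq)
          (metis add_diff_cancel_left')
    qed
    ultimately show ?thesis by (simp add: closed_Int_compact)
  qed
qed

lemma finite_dimensional_bounded_closed_imp_compact:
  fixes S :: "'a::real_normed_vector set"
  assumes "finite_dimensional TYPE('a)" "bounded S" "closed S"
  shows "compact S"
proof -
  obtain B :: "'a set" where B: "finite B" "span B = UNIV"
    using assms(1) unfolding finite_dimensional_def by blast
  obtain r where "\<forall>z\<in>S. norm z \<le> r"
    using assms(2) by (auto simp: bounded_iff)
  then have "S \<subseteq> cball 0 r" by auto
  then have "S = S \<inter> (cball 0 r \<inter> span B)" using B by auto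
  then show ?thesis
    using closed_Int_compact[OF assms(3) compact_cball_Int_span[OF B(1), of r]] by simp
qed

section \<open>The Bregman divergence and the mirror step\<close>

lemma prox_function_has_derivative:
  assumes "prox_function Q d" "x \<in> Q"
  shows "(d has_derivative frechet_derivative d (at x within Q)) (at x within Q)"
  using assms by (auto simp: prox_function_def differentiable_on_def frechet_derivative_works)

text \<open>A derivative relative to the convex set \<open>Q\<close> determines the one-sided slopes along segments inside
\<open>Q\<close>, also from boundary points. Both strong convexity and optimality of the mirror step
are statements about such slopes. The filter at 0 within the unit interval is the one-sided limit
\<open>t \<down> 0\<close>.\<close>

lemma difference_quotient_tendsto_derivative_within:
  fixes d :: "'a::real_normed_vector \<Rightarrow> real"
  assumes "(d has_derivative D) (at x within Q)" "convex Q" "x \<in> Q" "u \<in> Q"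
  shows "((\<lambda>t. (d (x + t *\<^sub>R (u - x)) - d x) / t) \<longlongrightarrow> D (u - x)) (at 0 within {0..1})"
proof -
  let ?l = "\<lambda>t. x + t *\<^sub>R (u - x)"
  have "?l ` {0..1} \<subseteq> Q"
    using assms(2-4) by (auto simp: convex_alt algebra_simps)
  then have "(d has_derivative D) (at (?l 0) within ?l ` {0..1})"
    using assms(1) has_derivative_subset by auto
  moreover have "(?l has_derivative (\<lambda>t. t *\<^sub>R (u - x))) (at 0 within {0..1})"
    by (auto intro!: derivative_eq_intros)
  ultimately have "((d \<circ> ?l) has_derivative (D \<circ> (\<lambda>t. t *\<^sub>R (u - x)))) (at 0 within {0..1})"
    by (rule diff_chain_within[rotated])
  moreover have "D \<circ> (\<lambda>t. t *\<^sub>R (u - x)) = (*) (D (u - x))"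
    using has_derivative_linear[OF assms(1)] by (auto simp: linear_scale mult.commute)
  ultimately have "((d \<circ> ?l) has_field_derivative D (u - x)) (at 0 within {0..1})"
    by (simp add: has_field_derivative_def)
  then show ?thesis by (simp add: has_field_derivative_iff)
qed

text \<open>The defining inequality of strong convexity, divided by \<open>t\<close>, bounds the slope of \<open>d\<close> on the segment
from \<open>x\<close> to \<open>u\<close>; the claim is its limit for \<open>t \<down> 0\<close>.\<close>

lemma Bregman_ge_half_norm_square:
  assumes "prox_function Q d" "x \<in> Q" "u \<in> Q"
  shows "Bregman Q d u x \<ge> (norm (u - x))\<^sup>2 / 2"
proof -
  let ?D = "frechet_derivative d (at x within Q)"
  have cvx: "convex Q" and sc: "strongly_convex_on 1 Q d"
    using assms(1) by (auto simp: prox_function_def strongly_convex_on_def)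
  have "?D (u - x) \<le> d u - d x - 1 / 2 * (1 - 0) * (norm (u - x))\<^sup>2"
  proof (rule tendsto_le)
    show "((\<lambda>t. d u - d x - 1 / 2 * (1 - t) * (norm (u - x))\<^sup>2) \<longlongrightarrow>
            d u - d x - 1 / 2 * (1 - 0) * (norm (u - x))\<^sup>2) (at 0 within {0..1})"
      by (intro tendsto_intros)
    show "((\<lambda>t. (d (x + t *\<^sub>R (u - x)) - d x) / t) \<longlongrightarrow> ?D (u - x)) (at 0 within {0..1})"
      by (rule difference_quotient_tendsto_derivative_within
          [OF prox_function_has_derivative[OF assms(1,2)] cvx assms(2,3)])
    have "(d (x + t *\<^sub>R (u - x)) - d x) / t \<le> d u - d x - 1 / 2 * (1 - t) * (norm (u - x))\<^sup>2"
      if t: "t \<in> {0..1}" "t \<noteq> 0" for t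
    proof -
      have "d ((1 - t) *\<^sub>R x + t *\<^sub>R u)
          \<le> (1 - t) * d x + t * d u - 1 / 2 * t * (1 - t) * (norm (x - u))\<^sup>2"
        using sc t assms(2,3) unfolding strongly_convex_on_def by blast
      moreover have "(1 - t) *\<^sub>R x + t *\<^sub>R u = x + t *\<^sub>R (u - x)" by (simp add: algebra_simps)
      ultimately have "d (x + t *\<^sub>R (u - x)) - d x
          \<le> (d u - d x - 1 / 2 * (1 - t) * (norm (u - x))\<^sup>2) * t"
        by (simp add: algebra_simps norm_minus_commute)
      then show ?thesis using t by (simp add: pos_divide_le_eq)
    qed
    then show "\<forall>\<^sub>F t in at 0 within {0..1}.
        (d (x + t *\<^sub>R (u - x)) - d x) / t \<le> d u - d x - 1 / 2 * (1 - t) * (norm (u - x))\<^sup>2"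
      by (auto simp: eventually_at_filter intro!: always_eventually)
  qed (simp add: trivial_limit_within islimpt_Icc)
  then show ?thesis by (simp add: Bregman_def)
qed

text \<open>\<open>Mirr\<close> is a chosen minimizer, so it has the minimizing property as soon as some minimizer exists;
continuity of \<open>d\<close> and of its linear derivative at \<open>x\<close> supplies one on a compact set.\<close>

lemma Mirr_is_arg_min:
  assumes "compact Q" "prox_function Q d" "x \<in> Q"
  shows "is_arg_min (\<lambda>u. blinfun_apply p u + Bregman Q d u x) (\<lambda>u. u \<in> Q) (Mirr Q d x p)"
proof -
  have "bounded_linear (frechet_derivative d (at x within Q))"
    using prox_function_has_derivative[OF assms(2,3)] by (rule has_derivative_bounded_linear)
  then have "continuous_on Q (\<lambda>u. frechet_derivative d (at x within Q) (u - x))"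
    by (rule bounded_linear.continuous_on) (intro continuous_intros)
  moreover have "continuous_on Q d"
    using assms(2) by (auto simp: prox_function_def differentiable_imp_continuous_on)
  ultimately have "continuous_on Q (\<lambda>u. blinfun_apply p u + Bregman Q d u x)"
    unfolding Bregman_def by (intro continuous_intros)
  then obtain v where "is_arg_min (\<lambda>u. blinfun_apply p u + Bregman Q d u x) (\<lambda>u. u \<in> Q) v"
    using continuous_attains_inf[OF assms(1), of "\<lambda>u. blinfun_apply p u + Bregman Q d u x"] assms(3)
    by (auto simp: is_arg_min_linorder)
  then show ?thesis unfolding Mirr_def arg_min_on_def arg_min_def by (rule someI)
qed

text \<open>First-order optimality of \<open>v\<close> turns into the three-point inequality
\<open>p (v - u) \<le> V(u, x) - V(u, v) - V(v, x)\<close>. What remains, \<open>p (x - v)\<close>, is absorbed by \<open>V(v, x)\<close> up to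
\<open>(norm p)\<^sup>2 / 2\<close>. The step size is part of \<open>p\<close>.\<close>

lemma mirror_step_inequality:
  fixes p :: "'a::real_normed_vector \<Rightarrow>\<^sub>L real"
  assumes Q: "compact Q" "prox_function Q d" and x: "x \<in> Q" and u: "u \<in> Q"
  defines "v \<equiv> Mirr Q d x p"
  shows "blinfun_apply p (x - u) \<le> (norm p)\<^sup>2 / 2 + Bregman Q d u x - Bregman Q d u v"
proof -
  note v_arg_min = Mirr_is_arg_min[OF Q x, of p, folded v_def]
  have v: "v \<in> Q" using v_arg_min by (simp add: is_arg_min_def)
  have v_min: "blinfun_apply p v + Bregman Q d v x \<le> blinfun_apply p w + Bregman Q d w x"
      if "w \<in> Q" for w
    using v_arg_min that by (simp add: is_arg_min_linorder)
  let ?Dx = "frechet_derivative d (at x within Q)"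
  let ?Dv = "frechet_derivative d (at v within Q)"
  have cvx: "convex Q" using Q(2) by (auto simp: prox_function_def strongly_convex_on_def)
  have lin: "linear ?Dx"
    using prox_function_has_derivative[OF Q(2) x] by (rule has_derivative_linear)
  \<comment> \<open>The slope of the minimized function at \<open>v\<close> towards \<open>u\<close> is nonnegative.\<close>
  have "?Dx (u - v) - blinfun_apply p (u - v) \<le> ?Dv (u - v)"
  proof (rule tendsto_lowerbound)
    show "((\<lambda>t. (d (v + t *\<^sub>R (u - v)) - d v) / t) \<longlongrightarrow> ?Dv (u - v)) (at 0 within {0..1})"
      by (rule difference_quotient_tendsto_derivative_within
          [OF prox_function_has_derivative[OF Q(2) v] cvx v u])
    have "?Dx (u - v) - blinfun_apply p (u - v) \<le> (d (v + t *\<^sub>R (u - v)) - d v) / t"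
      if t: "t \<in> {0..1}" "t \<noteq> 0" for t
    proof -
      have "(1 - t) *\<^sub>R v + t *\<^sub>R u \<in> Q" using cvx v u t by (simp add: convex_alt)
      then have "v + t *\<^sub>R (u - v) \<in> Q" by (simp add: algebra_simps)
      from v_min[OF this]
      have "t * (?Dx (u - v) - blinfun_apply p (u - v)) \<le> d (v + t *\<^sub>R (u - v)) - d v"
        using lin by (simp add: Bregman_def linear_add linear_diff linear_scale
            blinfun.bilinear_simps algebra_simps)
      then show ?thesis using t by (simp add: pos_le_divide_eq mult.commute)
    qed
    then show "\<forall>\<^sub>F t in at 0 within {0..1}.
        ?Dx (u - v) - blinfun_apply p (u - v) \<le> (d (v + t *\<^sub>R (u - v)) - d v) / t"
      by (auto simp: eventually_at_filter intro!: always_eventually)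
  qed (simp add: trivial_limit_within islimpt_Icc)
  then have three_point: "blinfun_apply p (v - u)
      \<le> Bregman Q d u x - Bregman Q d u v - Bregman Q d v x"
    using lin by (simp add: Bregman_def linear_diff blinfun.bilinear_simps)
  have "blinfun_apply p (x - v) \<le> norm p * norm (v - x)"
    using norm_blinfun[of p "x - v"] by (simp add: norm_minus_commute)
  also have "\<dots> \<le> (norm p)\<^sup>2 / 2 + (norm (v - x))\<^sup>2 / 2"
    using sum_squares_bound[of "norm p" "norm (v - x)"] by simp
  also have "\<dots> \<le> (norm p)\<^sup>2 / 2 + Bregman Q d v x"
    using Bregman_ge_half_norm_square[OF Q(2) x v] by simp
  finally show ?thesis using three_point by (simp add: blinfun.bilinear_simps)
qed

section \<open>Regret of mirror descent with adaptive steps\<close>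

text \<open>A discrete form of \<open>\<integral> dS / sqrt S = 2 * sqrt S\<close>: if \<open>S\<close> grows to \<open>T\<close>, then
\<open>(T - S) / sqrt T \<le> 2 * sqrt T - 2 * sqrt S\<close>, because \<open>(sqrt T - sqrt S)\<^sup>2 \<ge> 0\<close>. While the partial
sum vanishes, so does the summand, by the convention for division by zero.\<close>

lemma sum_divide_sqrt_partial_sums_le:
  fixes a :: "nat \<Rightarrow> real"
  assumes "\<And>k. a k \<ge> 0"
  shows "(\<Sum>k<n. a k / sqrt (\<Sum>i\<le>k. a i)) \<le> 2 * sqrt (\<Sum>i<n. a i)"
proof (induction n)
  case (Suc n)
  define S where "S = (\<Sum>i<n. a i)"
  define T where "T = (\<Sum>i\<le>n. a i)"
  have T: "T = S + a n" by (simp add: T_def S_def flip: lessThan_Suc_atMost)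
  have S: "S \<ge> 0" by (simp add: S_def assms sum_nonneg)
  have "a n / sqrt T \<le> 2 * sqrt T - 2 * sqrt S"
  proof (cases "T = 0")
    case True
    then show ?thesis using S T assms[of n] by simp
  next
    case False
    then have "T > 0" using S T assms[of n] by linarith
    have "a n = sqrt T * sqrt T - sqrt S * sqrt S" using S T assms[of n] by simp
    also have "\<dots> \<le> (2 * sqrt T - 2 * sqrt S) * sqrt T"
      using zero_le_power2[of "sqrt T - sqrt S"] by (simp add: power2_eq_square algebra_simps del: real_sqrt_mult_self)
    finally show ?thesis using \<open>T > 0\<close> by (simp add: pos_divide_le_eq)
  qed
  then show ?case using Suc.IH by (simp add: S_def T_def flip: lessThan_Suc_atMost)
qed simp

text \<open>Measuring \<open>v\<close> by its distance \<open>W - v k\<close> from the upper bound makes the sum telescope with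
nondecreasing weights: raising the weight of a nonnegative distance only enlarges the bound. The
bound keeps the term \<open>v (Suc n)\<close> so that it can be carried through the induction.\<close>

lemma weighted_telescoping_sum_le:
  fixes c v :: "nat \<Rightarrow> real"
  assumes "\<And>k. c k \<ge> 0" "mono c" "\<And>k. k < Suc n \<Longrightarrow> v k \<le> W"
  shows "(\<Sum>k<Suc n. c k * (v k - v (Suc k))) \<le> c n * (W - v (Suc n))"
  using assms(3)
proof (induction n)
  case 0
  then show ?case using assms(1)[of 0] by (simp add: mult_left_mono)
next
  case (Suc n)
  have "(\<Sum>k<Suc (Suc n). c k * (v k - v (Suc k)))
      \<le> c n * (W - v (Suc n)) + c (Suc n) * (v (Suc n) - v (Suc (Suc n)))"
    using Suc by simp
  also have "\<dots> \<le> c (Suc n) * (W - v (Suc n)) + c (Suc n) * (v (Suc n) - v (Suc (Suc n)))"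
    using Suc.prems[of "Suc n"] assms(2) by (intro add_right_mono mult_right_mono) (auto simp: mono_def)
  finally show ?case by (simp add: algebra_simps)
qed

text \<open>The step inequality is divided by the step size and summed; each of the two resulting sums
contributes one \<open>\<Theta> * sqrt (\<Sum>k<n. (norm (p k))\<^sup>2)\<close>. The covectors are arbitrary, so the bound does
not depend on which function they are subgradients of.\<close>

lemma mirror_descent_regret:
  fixes p :: "nat \<Rightarrow> 'a::real_normed_vector \<Rightarrow>\<^sub>L real"
  assumes Q: "compact Q" "prox_function Q d" and \<Theta>: "\<Theta> > 0"
    and V_le: "\<And>y z. y \<in> Q \<Longrightarrow> z \<in> Q \<Longrightarrow> Bregman Q d y z \<le> \<Theta>\<^sup>2"
    and x: "\<And>k. k \<le> n \<Longrightarrow> x k \<in> Q" and u: "u \<in> Q"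
    and pos: "\<And>k. k < n \<Longrightarrow> (\<Sum>i\<le>k. (norm (p i))\<^sup>2) > 0"
    and step: "\<And>k. k < n \<Longrightarrow>
      x (Suc k) = Mirr Q d (x k) ((\<Theta> / sqrt (\<Sum>i\<le>k. (norm (p i))\<^sup>2)) *\<^sub>R p k)"
  shows "(\<Sum>k<n. blinfun_apply (p k) (x k - u)) \<le> 2 * \<Theta> * sqrt (\<Sum>k<n. (norm (p k))\<^sup>2)"
proof (cases n)
  case (Suc n')
  define S where "S k = (\<Sum>i\<le>k. (norm (p i))\<^sup>2)" for k
  \<comment> \<open>The reciprocal of the step size.\<close>
  define c where "c k = sqrt (S k) / \<Theta>" for k
  define v where "v k = Bregman Q d u (x k)" for k
  have S_nonneg: "S k \<ge> 0" for k by (simp add: S_def sum_nonneg)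
  have "mono S" unfolding S_def by (intro monoI sum_mono2) auto
  then have "mono c" using \<Theta> by (auto simp: c_def mono_def divide_right_mono)
  have c_nonneg: "c k \<ge> 0" for k using \<Theta> S_nonneg by (simp add: c_def)
  have one_step: "blinfun_apply (p k) (x k - u)
      \<le> \<Theta> / 2 * ((norm (p k))\<^sup>2 / sqrt (S k)) + c k * (v k - v (Suc k))" if k: "k < n" for k
  proof -
    define h where "h = \<Theta> / sqrt (S k)"
    have Sk: "S k > 0" using pos[OF k] by (simp add: S_def)
    then have h: "h > 0" using \<Theta> by (simp add: h_def)
    have "x (Suc k) = Mirr Q d (x k) (h *\<^sub>R p k)" using step[OF k] by (simp add: h_def S_def)
    then have "h * blinfun_apply (p k) (x k - u) \<le> h\<^sup>2 * (norm (p k))\<^sup>2 / 2 + (v k - v (Suc k))"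
      using mirror_step_inequality[OF Q x u, of k "h *\<^sub>R p k"] k h
      by (simp add: v_def scaleR_blinfun.rep_eq power_mult_distrib)
    also have "\<dots> = h * (h / 2 * (norm (p k))\<^sup>2 + (v k - v (Suc k)) / h)"
      using h by (simp add: power2_eq_square field_simps)
    finally have "blinfun_apply (p k) (x k - u) \<le> h / 2 * (norm (p k))\<^sup>2 + (v k - v (Suc k)) / h"
      using h by simp
    then show ?thesis using \<Theta> by (simp add: h_def c_def mult.commute)
  qed
  have "(\<Sum>k<n. blinfun_apply (p k) (x k - u))
      \<le> (\<Sum>k<n. \<Theta> / 2 * ((norm (p k))\<^sup>2 / sqrt (S k)) + c k * (v k - v (Suc k)))"
    using one_step by (intro sum_mono) auto
  also have "\<dots> = \<Theta> / 2 * (\<Sum>k<n. (norm (p k))\<^sup>2 / sqrt (S k)) + (\<Sum>k<n. c k * (v k - v (Suc k)))"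
    by (simp add: sum.distrib sum_distrib_left)
  also have "\<dots> \<le> \<Theta> / 2 * (2 * sqrt (S n')) + c n' * \<Theta>\<^sup>2"
  proof (intro add_mono mult_left_mono)
    show "(\<Sum>k<n. (norm (p k))\<^sup>2 / sqrt (S k)) \<le> 2 * sqrt (S n')"
      using sum_divide_sqrt_partial_sums_le[of "\<lambda>k. (norm (p k))\<^sup>2" n] Suc
      by (simp add: S_def lessThan_Suc_atMost)
    have "v n \<ge> (norm (u - x n))\<^sup>2 / 2"
      unfolding v_def using Bregman_ge_half_norm_square[OF Q(2) x u] by simp
    then have "v n \<ge> 0" using zero_le_power2[of "norm (u - x n)"] by linarith
    have "(\<Sum>k<n. c k * (v k - v (Suc k))) \<le> c n' * (\<Theta>\<^sup>2 - v n)"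
      unfolding Suc using weighted_telescoping_sum_le[OF c_nonneg \<open>mono c\<close>, of n' v "\<Theta>\<^sup>2"] V_le u x Suc
      by (simp add: v_def)
    also have "\<dots> \<le> c n' * \<Theta>\<^sup>2" using \<open>v n \<ge> 0\<close> c_nonneg by (intro mult_left_mono) auto
    finally show "(\<Sum>k<n. c k * (v k - v (Suc k))) \<le> c n' * \<Theta>\<^sup>2" .
  qed (use \<Theta> in auto)
  also have "\<dots> = 2 * \<Theta> * sqrt (S n')"
    using \<Theta> by (simp add: c_def power2_eq_square)
  finally show ?thesis by (simp add: S_def Suc lessThan_Suc_atMost)
qed simp

section \<open>Termination and quality of the output\<close>

text \<open>The right-hand side of the test is at most \<open>A * sqrt (K * L)\<close> with
\<open>A = 2 * \<Theta> / \<epsilon> * (1 + 1 / \<gamma>)\<close>, which is at most \<open>K\<close> as soon as \<open>K \<ge> A\<^sup>2 * L\<close>.\<close>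

lemma stop_test_if_large:
  assumes "\<epsilon> > 0" "\<Theta> > 0" "\<gamma> > 0" "L > 0"
    and M_le: "\<And>i. i < K \<Longrightarrow> (M i)\<^sup>2 \<le> L"
    and K: "real K \<ge> 4 * L * \<Theta>\<^sup>2 * (1 + 1 / \<gamma>)\<^sup>2 / \<epsilon>\<^sup>2"
  shows "stop_test \<Theta> \<epsilon> \<gamma> M K"
proof -
  define A where "A = 2 * \<Theta> / \<epsilon> * (1 + 1 / \<gamma>)"
  have A: "A > 0" unfolding A_def using assms by (intro mult_pos_pos divide_pos_pos add_pos_pos) auto
  have "A\<^sup>2 * L = 4 * L * \<Theta>\<^sup>2 * (1 + 1 / \<gamma>)\<^sup>2 / \<epsilon>\<^sup>2"
    unfolding A_def power_mult_distrib power_divide by simp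
  then have KA: "real K \<ge> A\<^sup>2 * L" using K by simp
  then have "K \<ge> 1" using A assms(4)
    by (metis less_one not_le of_nat_0 mult_pos_pos zero_less_power)
  have "(\<Sum>i<K. (M i)\<^sup>2) \<le> real K * L"
    using sum_bounded_above[of "{..<K}" "\<lambda>i. (M i)\<^sup>2" L] M_le by simp
  then have "(A * sqrt (\<Sum>i<K. (M i)\<^sup>2))\<^sup>2 \<le> A\<^sup>2 * (real K * L)"
    by (simp add: power_mult_distrib sum_nonneg mult_left_mono)
  also have "\<dots> \<le> (real K)\<^sup>2"
    using mult_right_mono[OF KA, of "real K"] by (simp add: power2_eq_square mult_ac)
  finally have "A * sqrt (\<Sum>i<K. (M i)\<^sup>2) \<le> real K" by (rule power2_le_imp_le) simp
  then show ?thesis using \<open>K \<ge> 1\<close> by (simp add: stop_test_def A_def)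
qed

text \<open>Here \<open>r k\<close> is the loss of step \<open>k\<close>, \<open>F k\<close> the objective gap and \<open>I\<close> the set of productive steps. With
\<open>c = card I\<close> and all gaps at least \<open>D\<close>, the total loss is at least \<open>\<gamma> * D * c + \<epsilon> * (N - c)\<close>. If
\<open>D > \<epsilon>\<close>, multiplying by \<open>1 + \<gamma>\<close> and comparing with the upper bound would give
\<open>N - c + \<gamma>\<^sup>2 * c < 0\<close>, although \<open>c \<le> N\<close>. With \<open>c = 0\<close> the total would be at least \<open>\<epsilon> * N\<close>, which
exceeds the upper bound \<open>\<epsilon> * N / (1 + 1 / \<gamma>)\<close>.\<close>

lemma small_regret_imp_small_gap:
  fixes F r :: "nat \<Rightarrow> real"
  assumes \<epsilon>: "\<epsilon> > 0" and \<gamma>: "0 < \<gamma>" and N: "N \<ge> 1" and I: "I \<subseteq> {..<N}"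
    and prod: "\<And>k. k \<in> I \<Longrightarrow> \<gamma> * F k \<le> r k"
    and nonprod: "\<And>k. k < N \<Longrightarrow> k \<notin> I \<Longrightarrow> \<epsilon> \<le> r k"
    and regret: "(1 + 1 / \<gamma>) * (\<Sum>k<N. r k) \<le> \<epsilon> * real N"
  shows "I \<noteq> {}" and "(\<And>k. k \<in> I \<Longrightarrow> D \<le> F k) \<Longrightarrow> D \<le> \<epsilon>"
proof -
  have fin: "finite I" using I finite_subset by blast
  have "(\<Sum>k<N. r k) * (1 + \<gamma>) = \<gamma> * ((1 + 1 / \<gamma>) * (\<Sum>k<N. r k))"
    using \<gamma> by (simp add: field_simps)
  also have "\<dots> \<le> \<gamma> * (\<epsilon> * real N)" using regret \<gamma> by (intro mult_left_mono) auto
  finally have R: "(\<Sum>k<N. r k) * (1 + \<gamma>) \<le> \<gamma> * (\<epsilon> * real N)" .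
  have cN: "real (card I) \<le> real N" using card_mono[OF _ I] by simp
  have key: "\<gamma> * D * real (card I) + \<epsilon> * (real N - real (card I)) \<le> (\<Sum>k<N. r k)"
    if "\<And>k. k \<in> I \<Longrightarrow> D \<le> F k" for D
  proof -
    have "\<gamma> * D * real (card I) \<le> (\<Sum>k\<in>I. r k)"
    proof -
      have "\<gamma> * D \<le> r k" if "k \<in> I" for k
        using prod[OF that] \<open>\<And>k. k \<in> I \<Longrightarrow> D \<le> F k\<close>[OF that] \<gamma>
        by (meson mult_le_cancel_left_pos order_trans)
      then show ?thesis using sum_bounded_below[of I "\<gamma> * D" r] by (simp add: mult.commute)
    qed
    moreover have "\<epsilon> * (real N - real (card I)) \<le> (\<Sum>k\<in>{..<N} - I. r k)"
      using sum_bounded_below[of "{..<N} - I" \<epsilon> r] nonprod fin I cN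
      by (simp add: card_Diff_subset mult.commute of_nat_diff)
    moreover have "(\<Sum>k<N. r k) = (\<Sum>k\<in>{..<N} - I. r k) + (\<Sum>k\<in>I. r k)"
      using I by (simp add: sum.subset_diff)
    ultimately show ?thesis by linarith
  qed
  show ne: "I \<noteq> {}"
  proof
    assume "I = {}"
    then have "\<epsilon> * real N * (1 + \<gamma>) \<le> (\<Sum>k<N. r k) * (1 + \<gamma>)"
      using key[of 0] \<gamma> by (intro mult_right_mono) auto
    then have "\<epsilon> * real N \<le> 0" using R by (simp add: algebra_simps)
    then show False using \<epsilon> N by (simp add: mult_le_0_iff)
  qed
  assume D: "\<And>k. k \<in> I \<Longrightarrow> D \<le> F k"
  define c where "c = real (card I)"
  have c: "0 < c" "c \<le> real N" using ne fin cN by (auto simp: c_def card_gt_0_iff)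
  show "D \<le> \<epsilon>"
  proof (rule ccontr)
    assume "\<not> D \<le> \<epsilon>"
    then have "\<gamma> * \<epsilon> * c < \<gamma> * D * c" using \<gamma> c by simp
    then have "\<gamma> * \<epsilon> * c + \<epsilon> * (real N - c) < (\<Sum>k<N. r k)"
      using key[OF D] by (simp add: c_def)
    then have "(\<gamma> * \<epsilon> * c + \<epsilon> * (real N - c)) * (1 + \<gamma>) < (\<Sum>k<N. r k) * (1 + \<gamma>)"
      using \<gamma> by (intro mult_strict_right_mono) auto
    then have "(\<gamma> * \<epsilon> * c + \<epsilon> * (real N - c)) * (1 + \<gamma>) < \<gamma> * (\<epsilon> * real N)"
      using R by linarith
    then have "\<epsilon> * (real N - c + \<gamma>\<^sup>2 * c) < 0" by (simp add: algebra_simps power2_eq_square)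
    moreover have "\<epsilon> * (real N - c + \<gamma>\<^sup>2 * c) \<ge> 0" using \<epsilon> c by simp
    ultimately show False by linarith
  qed
qed

theorem theorem3p3:
  fixes Q :: "'a::real_normed_vector set"
    and d f :: "'a \<Rightarrow> real" and f' :: "'a \<Rightarrow> 'a \<Rightarrow>\<^sub>L real"
    and m :: nat and g :: "nat \<Rightarrow> 'a \<Rightarrow> real" and g' :: "nat \<Rightarrow> 'a \<Rightarrow> 'a \<Rightarrow>\<^sub>L real"
    and Mf Mg \<gamma> \<Theta> \<epsilon> :: real and Mgi :: "nat \<Rightarrow> real"
    and xs x0 :: 'a
    and x :: "nat \<Rightarrow> 'a" and q :: "nat \<Rightarrow> nat" and M h :: "nat \<Rightarrow> real"
  assumes "finite_dimensional TYPE('a)"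
    and "closed Q" and "convex Q"
    and "prox_function Q d"
    and "Mf > 0" and "Mf-lipschitz_on Q f"
    and "quasar_convex \<gamma> Q f f' xs"
    and "m \<ge> 1"
    and "\<And>i. i \<in> {1..m} \<Longrightarrow> convex_on Q (g i)"
    and "\<And>i. i \<in> {1..m} \<Longrightarrow> Mgi i > 0 \<and> (Mgi i)-lipschitz_on Q (g i)"
    and "\<And>i z. i \<in> {1..m} \<Longrightarrow> z \<in> Q \<Longrightarrow> g' i z \<in> subdifferential Q (g i) z"
    and "Mg = Max (Mgi ` {1..m})"
    and "is_arg_min f (\<lambda>z. z \<in> Q \<and> (\<forall>i\<in>{1..m}. g i z \<le> 0)) xs"
    and "\<exists>xbar \<in> interior Q. (MAX i\<in>{1..m}. g i xbar) \<le> 0"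
    and "\<And>z. z \<in> Q \<Longrightarrow> norm (f' z) \<le> Mf"
    and "\<And>i z. i \<in> {1..m} \<Longrightarrow> z \<in> Q \<Longrightarrow> norm (g' i z) \<le> Mg"
    and "\<Theta> > 0" and "\<And>y z. y \<in> Q \<Longrightarrow> z \<in> Q \<Longrightarrow> Bregman Q d y z \<le> \<Theta>\<^sup>2"
    and "\<epsilon> > 0" and "x0 \<in> Q"
    and "mirror_descent_run Q d f' m g g' \<Theta> \<epsilon> \<gamma> x0 x q M h"
    and "\<And>k. performed \<Theta> \<epsilon> \<gamma> M k \<Longrightarrow> (\<Sum>i\<le>k. (M i)\<^sup>2) > 0"
  shows "\<exists>N I. stops_after \<Theta> \<epsilon> \<gamma> M N \<and>
           I = {k. k < N \<and> productive m g \<epsilon> (x k)} \<and>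
           I \<noteq> {} \<and>
           int N \<le> \<lceil>4 * max (Mf\<^sup>2) (Mg\<^sup>2) * \<Theta>\<^sup>2 * (1 + 1 / \<gamma>)\<^sup>2 / \<epsilon>\<^sup>2\<rceil> \<and>
           (\<forall>xhat k. is_arg_min (\<lambda>i. f (x i)) (\<lambda>i. i \<in> I) k \<longrightarrow> xhat = x k \<longrightarrow>
              f xhat - f xs \<le> \<epsilon> \<and> (MAX i\<in>{1..m}. g i xhat) \<le> \<epsilon>)"
proof -
  note finite_dim = assms(1) and closed_Q = assms(2) and prox = assms(4) and \<Theta> = assms(17)
    and V_le = assms(18) and \<epsilon> = assms(19) and run = assms(21) and S_pos = assms(22)
  have \<gamma>: "0 < \<gamma>" using assms(7) by (simp add: quasar_convex_def)
  have quasar: "f z + 1 / \<gamma> * blinfun_apply (f' z) (xs - z) \<le> f xs" if "z \<in> Q" for z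
    using assms(7) that by (auto simp: quasar_convex_def)
  have xs: "xs \<in> Q" "\<And>i. i \<in> {1..m} \<Longrightarrow> g i xs \<le> 0"
    using assms(13) by (auto simp: is_arg_min_def)
  \<comment> \<open>By strong convexity the bound on the divergence also bounds the diameter of \<open>Q\<close>.\<close>
  have "dist x0 z \<le> 2 * \<Theta>" if "z \<in> Q" for z
  proof -
    have "(norm (x0 - z))\<^sup>2 \<le> 2 * \<Theta>\<^sup>2"
      using Bregman_ge_half_norm_square[OF prox that assms(20)] V_le[OF assms(20) that] by simp
    also have "\<dots> \<le> (2 * \<Theta>)\<^sup>2" by (simp add: power_mult_distrib)
    finally show ?thesis using \<Theta> by (auto simp: dist_norm intro: power2_le_imp_le)
  qed
  then have "bounded Q" unfolding bounded_def by blast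
  then have compact_Q: "compact Q"
    using finite_dimensional_bounded_closed_imp_compact finite_dim closed_Q by blast

  define p where "p k = (if productive m g \<epsilon> (x k) then f' (x k) else g' (q k) (x k))" for k
  define L where "L = max (Mf\<^sup>2) (Mg\<^sup>2)"
  have "L > 0" using assms(5) by (auto simp: L_def less_max_iff_disj)
  have M_p: "M k = norm (p k)"
    and step: "x (Suc k) = Mirr Q d (x k) ((\<Theta> / sqrt (\<Sum>i\<le>k. (M i)\<^sup>2)) *\<^sub>R p k)"
    and q: "\<not> productive m g \<epsilon> (x k) \<Longrightarrow> q k \<in> {1..m} \<and> g (q k) (x k) > \<epsilon>"
    if "performed \<Theta> \<epsilon> \<gamma> M k" for k
    using run that unfolding mirror_descent_run_def p_def by (auto split: if_splits)
  have x_Q: "x k \<in> Q" if "\<And>j. j < k \<Longrightarrow> performed \<Theta> \<epsilon> \<gamma> M j" for k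
    using that
  proof (induction k)
    case 0
    then show ?case using run assms(20) by (simp add: mirror_descent_run_def)
  next
    case (Suc k)
    then have "x k \<in> Q" by simp
    from Mirr_is_arg_min[OF compact_Q prox this] show ?case
      using step[of k] Suc.prems by (simp add: is_arg_min_def)
  qed
  have M_le: "(M k)\<^sup>2 \<le> L" if "\<And>j. j \<le> k \<Longrightarrow> performed \<Theta> \<epsilon> \<gamma> M j" for k
  proof -
    have "x k \<in> Q" using x_Q that by simp
    then have "norm (p k) \<le> Mf \<or> norm (p k) \<le> Mg"
      using assms(15,16) q[of k] that[of k] by (auto simp: p_def)
    then show ?thesis using M_p that[of k]
      by (auto simp: L_def le_max_iff_disj intro: power_mono)
  qed

  \<comment> \<open>If the test had not succeeded up to \<open>K\<close>, all of the steps before \<open>K\<close> would be genuine steps of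
      the algorithm, with gradients bounded by \<open>sqrt L\<close>.\<close>
  define K where "K = nat \<lceil>4 * L * \<Theta>\<^sup>2 * (1 + 1 / \<gamma>)\<^sup>2 / \<epsilon>\<^sup>2\<rceil>"
  have "\<exists>k\<le>K. stop_test \<Theta> \<epsilon> \<gamma> M k"
  proof (rule ccontr)
    assume *: "\<not> ?thesis"
    then have "performed \<Theta> \<epsilon> \<gamma> M j" if "j \<le> K" for j
      using that by (auto simp: performed_def)
    then have "stop_test \<Theta> \<epsilon> \<gamma> M K"
      using M_le by (intro stop_test_if_large[OF \<epsilon> \<Theta> \<gamma> \<open>L > 0\<close>]) (auto simp: K_def real_nat_ceiling_ge)
    with * show False by blast
  qed
  define N where "N = (LEAST k. stop_test \<Theta> \<epsilon> \<gamma> M k)"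
  have stop: "stop_test \<Theta> \<epsilon> \<gamma> M N" and not_stop: "\<And>j. j < N \<Longrightarrow> \<not> stop_test \<Theta> \<epsilon> \<gamma> M j"
    and "N \<le> K"
    using \<open>\<exists>k\<le>K. stop_test \<Theta> \<epsilon> \<gamma> M k\<close> unfolding N_def
    by (blast intro: LeastI Least_le order_trans dest: not_less_Least)+
  then have performed: "performed \<Theta> \<epsilon> \<gamma> M k" if "k < N" for k
    using that by (auto simp: performed_def)
  define I where "I = {k. k < N \<and> productive m g \<epsilon> (x k)}"

  have sum_M: "(\<Sum>i\<le>k. (M i)\<^sup>2) = (\<Sum>i\<le>k. (norm (p i))\<^sup>2)" if "k < N" for k
    using M_p performed that by (intro sum.cong) auto
  have regret: "(\<Sum>k<N. blinfun_apply (p k) (x k - xs)) \<le> 2 * \<Theta> * sqrt (\<Sum>k<N. (M k)\<^sup>2)"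
  proof -
    have "(\<Sum>k<N. blinfun_apply (p k) (x k - xs)) \<le> 2 * \<Theta> * sqrt (\<Sum>k<N. (norm (p k))\<^sup>2)"
    proof (rule mirror_descent_regret[OF compact_Q prox \<Theta> V_le _ xs(1)])
      show "x k \<in> Q" if "k \<le> N" for k using x_Q performed that by simp
      show "(\<Sum>i\<le>k. (norm (p i))\<^sup>2) > 0" if "k < N" for k
        using S_pos[OF performed[OF that]] sum_M[OF that] by simp
      show "x (Suc k) = Mirr Q d (x k) ((\<Theta> / sqrt (\<Sum>i\<le>k. (norm (p i))\<^sup>2)) *\<^sub>R p k)"
        if "k < N" for k
        using step[OF performed[OF that]] unfolding sum_M[OF that] .
    qed
    then show ?thesis using M_p performed by simp
  qed
  have productive_gap: "\<gamma> * (f (x k) - f xs) \<le> blinfun_apply (p k) (x k - xs)" if "k \<in> I" for k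
  proof -
    have "x k \<in> Q" using x_Q performed that by (simp add: I_def)
    from quasar[OF this] have "f (x k) - f xs \<le> blinfun_apply (p k) (x k - xs) / \<gamma>"
      using that by (simp add: I_def p_def blinfun.diff_right diff_divide_distrib)
    then show ?thesis using \<gamma> by (simp add: field_simps)
  qed
  have nonproductive_gap: "\<epsilon> \<le> blinfun_apply (p k) (x k - xs)" if "k < N" "k \<notin> I" for k
  proof -
    have np: "\<not> productive m g \<epsilon> (x k)" using that by (simp add: I_def)
    then have qk: "q k \<in> {1..m}" "g (q k) (x k) > \<epsilon>" using q performed that by auto
    have "x k \<in> Q" using x_Q performed that by simp
    then have "g (q k) xs \<ge> g (q k) (x k) + blinfun_apply (p k) (xs - x k)"
      using assms(11)[OF qk(1)] xs(1) np by (simp add: subdifferential_def p_def)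
    then show ?thesis using qk xs(2)[OF qk(1)] by (simp add: blinfun.diff_right)
  qed
  have "(1 + 1 / \<gamma>) * (\<Sum>k<N. blinfun_apply (p k) (x k - xs))
      \<le> (1 + 1 / \<gamma>) * (2 * \<Theta> * sqrt (\<Sum>k<N. (M k)\<^sup>2))"
    using regret \<gamma> by (intro mult_left_mono) auto
  also have "\<dots> = \<epsilon> * (2 * \<Theta> / \<epsilon> * (1 + 1 / \<gamma>) * sqrt (\<Sum>k<N. (M k)\<^sup>2))"
    using \<epsilon> by simp
  also have "\<dots> \<le> \<epsilon> * real N"
    using stop \<epsilon> unfolding stop_test_def by (intro mult_left_mono) auto
  finally have small: "(1 + 1 / \<gamma>) * (\<Sum>k<N. blinfun_apply (p k) (x k - xs)) \<le> \<epsilon> * real N" .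
  have "N \<ge> 1" "I \<subseteq> {..<N}" using stop by (auto simp: stop_test_def I_def)
  note gap = small_regret_imp_small_gap[OF \<epsilon> \<gamma> this productive_gap nonproductive_gap small]

  show ?thesis
  proof (intro exI[of _ N] exI[of _ I] conjI allI impI)
    show "stops_after \<Theta> \<epsilon> \<gamma> M N" using stop not_stop by (simp add: stops_after_def)
    show "I = {k. k < N \<and> productive m g \<epsilon> (x k)}" by (rule I_def)
    show "I \<noteq> {}" by (rule gap(1))
    show "int N \<le> \<lceil>4 * max (Mf\<^sup>2) (Mg\<^sup>2) * \<Theta>\<^sup>2 * (1 + 1 / \<gamma>)\<^sup>2 / \<epsilon>\<^sup>2\<rceil>"
      using \<open>N \<le> K\<close> \<open>N \<ge> 1\<close> unfolding K_def L_def by linarith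
  next
    fix xhat k
    assume k: "is_arg_min (\<lambda>i. f (x i)) (\<lambda>i. i \<in> I) k" and xhat: "xhat = x k"
    show "f xhat - f xs \<le> \<epsilon>"
      unfolding xhat using k by (intro gap(2)) (auto simp: is_arg_min_linorder)
    show "(MAX i\<in>{1..m}. g i xhat) \<le> \<epsilon>"
      unfolding xhat using k assms(8) by (auto simp: is_arg_min_def I_def productive_def)
  qed
qed

end
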